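(* Let $\Omega$ be a complex manifold and let $\lambda_0$ be a distinguished point of $\Omega$. Let $E\subset\mathbb{C}$, let $\varphi:\Omega\to\overline{\mathbb{C}}$ be a holomorphic mapping such that $\varphi(\lambda_0)=0$, and consider $$f:\Omega\times E\to\overline{\mathbb{C}},\qquad f(\lambda,z)=z+\varphi(\lambda).$$ The following are equivalent: a) $\varphi(\lambda)\neq\infty$ for all $\lambda\in\Omega$; b) $f$ is a holomorphic motion (of $E$ in $\overline{\mathbb{C}}$, parametrized by $\Omega$ with base point $\lambda_0$); c) $f$ is a holomorphic motion in $\mathbb{C}$ (of $E$, parametrized by $\Omega$ with base point $\lambda_0$).
   Context: $\overline{\mathbb{C}}=\mathbb{C}\cup\{\infty\}$ is the Riemann sphere; by convention $z+\infty=\infty$ for $z\in\mathbb{C}$. Let $W$ be a complex manifold with distinguished point $\lambda_0$ and let $E\subset\overline{\mathbb{C}}$. A holomorphic motion of $E$ in $\overline{\mathbb{C}}$, parametrized by $W$ with base point $\lambda_0$, is a map $f:W\times E\to\overline{\mathbb{C}}$ such that: (1) $f(\lambda_0,z)=z$ for all $z\in E$; (2) for every fixed $\lambda\in W$, the map $z\mapsto f(\lambda,z)$ is injective on $E$; (3) for every fixed $z\in E$, the map $\lambda\mapsto f(\lambda,z)$ is a holomorphic map from $W$ to $\overline{\mathbb{C}}$. If $E\subset\mathbb{C}$, a holomorphic motion of $E$ in $\mathbb{C}$ is a map $f:W\times E\to\mathbb{C}$ (i.e. taking only finite values) with the same three properties.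
   Formalization: E is assumed to have at least two points: for E empty or a single point the claim fails, e.g. Ω the Riemann sphere, base point 0, φ the identity, E={0}, where b) holds but a) does not. *)

theory Defs
  imports "HOL-Analysis.Analysis"
begin

text \<open>
  Holomorphy in several complex variables: Frechet differentiability with a complex-linear
  derivative, the matrix \<open>D\<close> being the complex Jacobian. The derivative is taken within \<open>S\<close>
  because \<open>S\<close> is only required to be open in a complex subspace of \<open>\<complex>\<^sup>n\<close>
  (see \<open>complex_manifold\<close> below).
\<close>

definition holomorphic_vec :: "(complex^'n \<Rightarrow> complex^'m) \<Rightarrow> (complex^'n) set \<Rightarrow> bool"
  where "holomorphic_vec F S \<longleftrightarrow>
    (\<forall>x\<in>S. \<exists>D :: complex^'n^'m. (F has_derivative (\<lambda>v. D *v v)) (at x within S))"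

record ('p, 'n) complex_mfd =
  topology_of :: "'p topology"
  atlas_of :: "('p set \<times> ('p \<Rightarrow> complex^'n)) set"

abbreviation points_of :: "('p, 'n::finite) complex_mfd \<Rightarrow> 'p set"
  where "points_of M \<equiv> topspace (topology_of M)"

text \<open>
  A chart \<open>(U, \<psi>)\<close> maps \<open>U\<close> homeomorphically onto an open subset of some complex linear
  subspace \<open>V\<close> of \<open>\<complex>\<^sup>n\<close>. Fixing \<open>V = \<complex>\<^sup>n\<close> would exclude dimension 0, since an index type is
  never empty; a manifold of dimension \<open>d\<close> is the case where all \<open>V\<close> have dimension \<open>d\<close>.
  Manifolds are not assumed to be connected.
\<close>

definition complex_chart ::
    "'p topology \<Rightarrow> 'p set \<Rightarrow> ('p \<Rightarrow> complex^'n) \<Rightarrow> bool"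
  where "complex_chart X U \<psi> \<longleftrightarrow>
    openin X U \<and>
    (\<exists>V. vec.subspace V \<and> openin (top_of_set V) (\<psi> ` U)) \<and>
    homeomorphic_map (subtopology X U) (top_of_set (\<psi> ` U)) \<psi>"

definition complex_manifold :: "('p, 'n::finite) complex_mfd \<Rightarrow> bool"
  where "complex_manifold M \<longleftrightarrow>
    Hausdorff_space (topology_of M) \<and>
    second_countable (topology_of M) \<and>
    (\<forall>(U, \<psi>) \<in> atlas_of M. complex_chart (topology_of M) U \<psi>) \<and>
    (\<Union>(U, \<psi>) \<in> atlas_of M. U) = points_of M \<and>
    (\<forall>(U, \<psi>) \<in> atlas_of M. \<forall>(U', \<psi>') \<in> atlas_of M.
       holomorphic_vec (\<psi>' \<circ> inv_into U \<psi>) (\<psi> ` (U \<inter> U')))"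

definition holomorphic_mfd_map ::
    "('p, 'n::finite) complex_mfd \<Rightarrow> ('q, 'm::finite) complex_mfd \<Rightarrow> ('p \<Rightarrow> 'q) \<Rightarrow> bool"
  where "holomorphic_mfd_map M N g \<longleftrightarrow>
    continuous_map (topology_of M) (topology_of N) g \<and>
    (\<forall>(U, \<psi>) \<in> atlas_of M. \<forall>(W, \<kappa>) \<in> atlas_of N.
       holomorphic_vec (\<kappa> \<circ> g \<circ> inv_into U \<psi>) (\<psi> ` (U \<inter> g -` W)))"

text \<open>
  The complex plane and the Riemann sphere as one-dimensional manifolds; \<open>vec\<close> identifies
  \<open>\<complex>\<close> with \<open>\<complex>\<^sup>1\<close>. The sphere is the one-point compactification of \<open>\<complex>\<close>, with \<open>None\<close> as the point
  at infinity and the charts \<open>w \<mapsto> w\<close> off infinity and \<open>w \<mapsto> 1/w\<close> off 0.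
\<close>

definition complex_plane :: "(complex, 1) complex_mfd"
  where "complex_plane = \<lparr>topology_of = euclidean, atlas_of = {(UNIV, vec)}\<rparr>"

type_synonym sphere = "complex option"

abbreviation sphere_infinity :: sphere  (\<open>\<infinity>\<^sub>S\<close>)
  where "\<infinity>\<^sub>S \<equiv> None"

definition sphere_inverse :: "sphere \<Rightarrow> complex"
  where "sphere_inverse w = (case w of None \<Rightarrow> 0 | Some z \<Rightarrow> 1 / z)"

definition riemann_sphere :: "(sphere, 1) complex_mfd"
  where "riemann_sphere =
    \<lparr>topology_of = Alexandroff_compactification euclidean,
     atlas_of = {(- {\<infinity>\<^sub>S}, \<lambda>w. vec (the w)), (- {Some 0}, \<lambda>w. vec (sphere_inverse w))}\<rparr>"

definition sphere_add :: "complex \<Rightarrow> sphere \<Rightarrow> sphere"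
  where "sphere_add z w = (case w of None \<Rightarrow> \<infinity>\<^sub>S | Some u \<Rightarrow> Some (z + u))"

text \<open>
  Holomorphic motion of \<open>E \<subseteq> N\<close> in \<open>N\<close>, parametrized by \<open>W\<close> with base point \<open>l0\<close>. Taking \<open>N\<close> to be
  the Riemann sphere or the complex plane gives motions in either; only the values of \<open>f\<close> on
  \<open>W \<times> E\<close> matter.
\<close>

definition holomorphic_motion ::
    "('q, 'm::finite) complex_mfd \<Rightarrow> ('p, 'n::finite) complex_mfd \<Rightarrow> 'p \<Rightarrow> 'q set
      \<Rightarrow> ('p \<Rightarrow> 'q \<Rightarrow> 'q) \<Rightarrow> bool"
  where "holomorphic_motion N W l0 E f \<longleftrightarrow>
    E \<subseteq> points_of N \<and>
    (\<forall>z\<in>E. f l0 z = z) \<and>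
    (\<forall>l\<in>points_of W. inj_on (f l) E) \<and>
    (\<forall>z\<in>E. holomorphic_mfd_map W N (\<lambda>l. f l z))"

end

theory Submission
  imports Defs
begin

text \<open>
  A translation of the sphere collapses all of \<open>\<complex>\<close> to the point \<open>\<infinity>\<close> when the translation vector
  is \<open>\<infinity>\<close>, so injectivity on two points already forces \<open>\<phi>\<close> to be finite. Conversely a finite
  \<open>\<phi>\<close> is a holomorphic function into \<open>\<complex>\<close>, and so are its translates; the inclusion
  \<open>Some\<close> of the plane into the sphere is holomorphic.
\<close>

lemma holomorphic_vec_subset:
  "holomorphic_vec F S \<Longrightarrow> T \<subseteq> S \<Longrightarrow> holomorphic_vec F T"
  unfolding holomorphic_vec_def by (meson has_derivative_subset subsetD)

lemma holomorphic_vec_cong: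
  assumes "\<And>x. x \<in> S \<Longrightarrow> F x = G x"
  shows "holomorphic_vec F S \<longleftrightarrow> holomorphic_vec G S"
  unfolding holomorphic_vec_def using assms
  by (metis has_derivative_transform)

text \<open>The chain rule for a one-variable \<open>g\<close> after a scalar function of several
  variables. It serves twice: for entire functions applied to a map into the plane, and for the
  reciprocal that appears in the chart of the sphere at infinity.\<close>

lemma holomorphic_vec_compose_field:
  fixes h :: "complex^'n \<Rightarrow> complex"
  assumes "holomorphic_vec (\<lambda>x. vec (h x) :: complex^1) S"
    and "\<And>x. x \<in> S \<Longrightarrow> \<exists>d. (g has_field_derivative d) (at (h x))"
  shows "holomorphic_vec (\<lambda>x. vec (g (h x)) :: complex^1) S"
  unfolding holomorphic_vec_def
proof
  fix x assume x: "x \<in> S"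
  obtain D :: "complex^'n^1" where
    D: "((\<lambda>x. vec (h x) :: complex^1) has_derivative (*v) D) (at x within S)"
    using assms(1) x unfolding holomorphic_vec_def by blast
  obtain d where d: "(g has_field_derivative d) (at (h x))"
    using assms(2) x by blast
  have "(h has_derivative (\<lambda>v. (D *v v) $ 1)) (at x within S)"
    using bounded_linear.has_derivative[OF bounded_linear_vec_nth D, of 1] by simp
  from has_derivative_compose[OF this d[unfolded has_field_derivative_def]]
  have g: "((\<lambda>x. g (h x)) has_derivative (\<lambda>v. d * (D *v v) $ 1)) (at x within S)" .
  have "bounded_linear (vec :: complex \<Rightarrow> complex^1)"
    by (intro linear_conv_bounded_linear[THEN iffD1] linearI) (auto simp: vec_eq_iff)
  from bounded_linear.has_derivative[OF this g]
  have "((\<lambda>x. vec (g (h x)) :: complex^1) has_derivative (\<lambda>v. vec (d * (D *v v) $ 1))) (at x within S)" .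
  \<comment> \<open>Scaling the one-row Jacobian by \<open>d\<close> gives a complex matrix again,
    so the derivative remains complex-linear.\<close>
  moreover have "(\<lambda>v. vec (d * (D *v v) $ 1)) = (*v) (\<chi> i j. d * D $ i $ j)"
    by (simp add: fun_eq_iff vec_eq_iff forall_1 matrix_vector_mult_def sum_distrib_left mult.assoc)
  ultimately show "\<exists>D. ((\<lambda>x. vec (g (h x)) :: complex^1) has_derivative (*v) D) (at x within S)"
    by auto
qed

lemma complex_manifold_chart_subset:
  "complex_manifold M \<Longrightarrow> (U, \<psi>) \<in> atlas_of M \<Longrightarrow> U \<subseteq> points_of M"
  unfolding complex_manifold_def by blast

text \<open>Ensures that \<open>inv_into U \<psi>\<close> undoes \<open>\<psi>\<close> on all of
  \<open>U\<close>, so that conditions on points of \<open>U\<close> can be read off in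
  coordinates.\<close>

lemma complex_manifold_chart_inj:
  assumes "complex_manifold M" "(U, \<psi>) \<in> atlas_of M"
  shows "inj_on \<psi> U"
proof -
  have "homeomorphic_map (subtopology (topology_of M) U) (top_of_set (\<psi> ` U)) \<psi>"
    using assms unfolding complex_manifold_def complex_chart_def by blast
  from homeomorphic_imp_injective_map[OF this] show ?thesis
    using complex_manifold_chart_subset[OF assms] by (simp add: Int_absorb1)
qed

text \<open>Chart domains consist of points of \<open>M\<close>, and every preimage is intersected
  with such a domain, so values elsewhere never enter.\<close>

lemma holomorphic_mfd_map_cong:
  assumes M: "complex_manifold M" and eq: "\<And>l. l \<in> points_of M \<Longrightarrow> g l = h l"
  shows "holomorphic_mfd_map M N g \<longleftrightarrow> holomorphic_mfd_map M N h"
proof -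
  have "holomorphic_vec (\<kappa> \<circ> g \<circ> inv_into U \<psi>) (\<psi> ` (U \<inter> g -` W))
      \<longleftrightarrow> holomorphic_vec (\<kappa> \<circ> h \<circ> inv_into U \<psi>) (\<psi> ` (U \<inter> h -` W))"
    if "(U, \<psi>) \<in> atlas_of M" for U \<psi> W and \<kappa> :: "'c \<Rightarrow> complex^'d"
  proof -
    have U: "g l = h l" if "l \<in> U" for l
      using complex_manifold_chart_subset[OF M \<open>(U, \<psi>) \<in> atlas_of M\<close>] eq that by blast
    have S: "U \<inter> g -` W = U \<inter> h -` W"
      using U by auto
    show ?thesis
      unfolding S by (rule holomorphic_vec_cong) (auto simp: U inv_into_into)
  qed
  moreover have "continuous_map (topology_of M) (topology_of N) g
      \<longleftrightarrow> continuous_map (topology_of M) (topology_of N) h"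
    using eq by (metis continuous_map_eq)
  ultimately show ?thesis
    unfolding holomorphic_mfd_map_def by fast
qed

lemma holomorphic_mfd_map_plane_iff:
  "holomorphic_mfd_map M complex_plane h \<longleftrightarrow>
    continuous_map (topology_of M) euclidean h \<and>
    (\<forall>(U, \<psi>) \<in> atlas_of M. holomorphic_vec (\<lambda>x. vec (h (inv_into U \<psi> x)) :: complex^1) (\<psi> ` U))"
  by (simp add: holomorphic_mfd_map_def complex_plane_def o_def)

lemma holomorphic_mfd_map_plane_compose:
  assumes h: "holomorphic_mfd_map M complex_plane h" and g: "g holomorphic_on UNIV"
  shows "holomorphic_mfd_map M complex_plane (\<lambda>l. g (h l))"
  unfolding holomorphic_mfd_map_plane_iff
proof (intro conjI ballI, goal_cases)
  case 1
  have "continuous_map euclidean euclidean g"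
    using holomorphic_on_imp_continuous_on[OF g] by simp
  then show ?case
    using h continuous_map_compose[of _ _ h _ g]
    unfolding holomorphic_mfd_map_plane_iff o_def by blast
next
  case (2 c)
  have g': "\<exists>d. (g has_field_derivative d) (at w)" for w
    using g by (auto simp: holomorphic_on_def field_differentiable_def)
  obtain U \<psi> where c: "c = (U, \<psi>)"
    by fastforce
  have "holomorphic_vec (\<lambda>x. vec (h (inv_into U \<psi> x)) :: complex^1) (\<psi> ` U)"
    using h 2 c unfolding holomorphic_mfd_map_plane_iff by fast
  from holomorphic_vec_compose_field[OF this g'] show ?case
    by (simp add: c)
qed

text \<open>In the chart off infinity the map reads as \<open>h\<close> itself, on the whole chart
  domain, so only continuity calls for an argument.\<close>

lemma holomorphic_mfd_map_finite_sphere: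
  assumes h: "holomorphic_mfd_map M riemann_sphere (\<lambda>l. Some (h l))"
  shows "holomorphic_mfd_map M complex_plane h"
proof -
  have c: "continuous_map (topology_of M) (Alexandroff_compactification euclidean) (\<lambda>l. Some (h l))"
    using h by (simp add: holomorphic_mfd_map_def riemann_sphere_def)
  have "continuous_map (topology_of M) euclidean h"
    unfolding continuous_map_def
  proof (intro conjI allI impI)
    fix U :: "complex set" assume "openin euclidean U"
    \<comment> \<open>\<open>Some\<close> is an open map into the compactification, so preimages
      under \<open>h\<close> are preimages of open subsets of the sphere.\<close>
    then have "openin (Alexandroff_compactification euclidean) (Some ` U)"
      by (auto simp: openin_Alexandroff_compactification)
    from openin_continuous_map_preimage[OF c this]
    show "openin (topology_of M) {x \<in> points_of M. h x \<in> U}"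
      by (simp add: image_iff)
  qed simp
  then show ?thesis
    using h unfolding holomorphic_mfd_map_plane_iff
    by (auto simp: holomorphic_mfd_map_def riemann_sphere_def o_def vimage_def split: prod.splits)
qed

lemma holomorphic_mfd_map_Some:
  assumes M: "complex_manifold M" and h: "holomorphic_mfd_map M complex_plane h"
  shows "holomorphic_mfd_map M riemann_sphere (\<lambda>l. Some (h l))"
proof -
  have c: "continuous_map (topology_of M) euclidean h"
    using h by (simp add: holomorphic_mfd_map_plane_iff)
  have "continuous_map euclidean (Alexandroff_compactification euclidean) (Some :: complex \<Rightarrow> _)"
    by (simp add: continuous_map_Some)
  from continuous_map_compose[OF c this]
  have c': "continuous_map (topology_of M) (Alexandroff_compactification euclidean) (\<lambda>l. Some (h l))"
    by (simp add: o_def)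
  have 1: "holomorphic_vec (\<lambda>x. vec (h (inv_into U \<psi> x)) :: complex^1) (\<psi> ` (U \<inter> T))"
    if "(U, \<psi>) \<in> atlas_of M" for U \<psi> T
    using h that unfolding holomorphic_mfd_map_plane_iff
    by (fast intro: holomorphic_vec_subset)
  \<comment> \<open>The condition in the chart \<open>1/w\<close>, whose domain pulls back to the
    points where \<open>h\<close> does not vanish; there the reciprocal is differentiable.\<close>
  have "holomorphic_vec (\<lambda>x. vec (1 / h (inv_into U \<psi> x)) :: complex^1) (\<psi> ` (U \<inter> {l. h l \<noteq> 0}))"
    if "(U, \<psi>) \<in> atlas_of M" for U \<psi>
  proof (rule holomorphic_vec_compose_field[OF 1[OF that], where g = "\<lambda>w. 1 / w"])
    fix x assume "x \<in> \<psi> ` (U \<inter> {l. h l \<noteq> 0})"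
    then have "h (inv_into U \<psi> x) \<noteq> 0"
      using complex_manifold_chart_inj[OF M that] by auto
    then show "\<exists>d. ((\<lambda>w. 1 / w) has_field_derivative d) (at (h (inv_into U \<psi> x)))"
      by (auto intro!: derivative_eq_intros exI)
  qed
  with 1[of _ _ UNIV] c' show ?thesis
    by (auto simp: holomorphic_mfd_map_def riemann_sphere_def sphere_inverse_def o_def vimage_def)
qed

text \<open>Two distinct points in \<open>E\<close> matter: on a single point every translation is
  injective, even the one by infinity, so b) would not give a). Since plane and sphere are different
  types, a motion in the plane is a map \<open>g\<close> through which \<open>f\<close> factors by
  \<open>Some\<close>.\<close>

theorem lemma6p1:
  fixes \<Omega> :: "('p, 'n::finite) complex_mfd"
    and l0 :: 'p
    and E :: "complex set"
    and \<phi> :: "'p \<Rightarrow> sphere"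
    and f :: "'p \<Rightarrow> sphere \<Rightarrow> sphere"
  assumes "complex_manifold \<Omega>"
    and "l0 \<in> points_of \<Omega>"
    and "\<exists>z\<in>E. \<exists>w\<in>E. z \<noteq> w"
    and "holomorphic_mfd_map \<Omega> riemann_sphere \<phi>"
    and "\<phi> l0 = Some 0"
    and "\<And>l z. l \<in> points_of \<Omega> \<Longrightarrow> z \<in> E \<Longrightarrow> f l (Some z) = sphere_add z (\<phi> l)"
  shows "((\<forall>l\<in>points_of \<Omega>. \<phi> l \<noteq> \<infinity>\<^sub>S) \<longleftrightarrow>
           holomorphic_motion riemann_sphere \<Omega> l0 (Some ` E) f) \<and>
         (holomorphic_motion riemann_sphere \<Omega> l0 (Some ` E) f \<longleftrightarrow>
           (\<exists>g :: 'p \<Rightarrow> complex \<Rightarrow> complex.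
              (\<forall>l\<in>points_of \<Omega>. \<forall>z\<in>E. f l (Some z) = Some (g l z)) \<and>
              holomorphic_motion complex_plane \<Omega> l0 E g))"
proof -
  let ?a = "\<forall>l\<in>points_of \<Omega>. \<phi> l \<noteq> \<infinity>\<^sub>S"
  let ?b = "holomorphic_motion riemann_sphere \<Omega> l0 (Some ` E) f"
  let ?c = "\<exists>g :: 'p \<Rightarrow> complex \<Rightarrow> complex.
    (\<forall>l\<in>points_of \<Omega>. \<forall>z\<in>E. f l (Some z) = Some (g l z)) \<and>
    holomorphic_motion complex_plane \<Omega> l0 E g"
  note M = assms(1) and f = assms(6)
  obtain z w where zw: "z \<in> E" "w \<in> E" "z \<noteq> w"
    using assms(3) by blast
  have ba: ?a if ?b
  proof (intro ballI notI)
    fix l assume l: "l \<in> points_of \<Omega>" "\<phi> l = \<infinity>\<^sub>S"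
    then have "f l (Some z) = f l (Some w)"
      using zw f by (simp add: sphere_add_def)
    moreover have "inj_on (f l) (Some ` E)"
      using that l by (simp add: holomorphic_motion_def)
    ultimately show False
      using zw by (auto dest: inj_onD)
  qed
  \<comment> \<open>One point of \<open>E\<close> suffices here, since \<open>f\<close> takes only
    finite values. With \<open>ba\<close> and \<open>abc\<close> this yields both equivalences by
    propositional logic.\<close>
  have ca: ?a if c: ?c
  proof (intro ballI notI)
    fix l assume l: "l \<in> points_of \<Omega>" "\<phi> l = \<infinity>\<^sub>S"
    obtain g :: "'p \<Rightarrow> complex \<Rightarrow> complex" where "f l (Some z) = Some (g l z)"
      using c l(1) zw(1) by fast
    then show False
      using f[OF l(1) zw(1)] l(2) by (simp add: sphere_add_def)
  qed
  have abc: "?b \<and> ?c" if ?a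
  proof -
    \<comment> \<open>The finite representative of \<open>\<phi>\<close>. Off the points of
      \<open>\<Omega>\<close> the value of \<open>the\<close> may be unspecified, hence the passage
      through \<open>holomorphic_mfd_map_cong\<close> below.\<close>
    define u where "u l = the (\<phi> l)" for l
    have u: "\<phi> l = Some (u l)" if "l \<in> points_of \<Omega>" for l
      using \<open>?a\<close> that by (auto simp: u_def)
    have fu: "f l (Some x) = Some (x + u l)" if "l \<in> points_of \<Omega>" "x \<in> E" for l x
      using f u that by (simp add: sphere_add_def)
    have u0: "u l0 = 0"
      using assms(5) by (simp add: u_def)
    have "holomorphic_mfd_map \<Omega> riemann_sphere (\<lambda>l. Some (u l))"
      using assms(4) u by (subst holomorphic_mfd_map_cong[OF M, where h = \<phi>]) auto
    then have "holomorphic_mfd_map \<Omega> complex_plane u"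
      by (rule holomorphic_mfd_map_finite_sphere)
    then have plane: "holomorphic_mfd_map \<Omega> complex_plane (\<lambda>l. x + u l)" for x
      by (rule holomorphic_mfd_map_plane_compose) (intro holomorphic_intros)
    \<comment> \<open>The translate is holomorphic into the plane first and is then included into
      the sphere, which avoids computing with \<open>sphere_add\<close> in charts.\<close>
    have "holomorphic_mfd_map \<Omega> riemann_sphere (\<lambda>l. f l (Some x))" if "x \<in> E" for x
      using holomorphic_mfd_map_Some[OF M plane] fu that
      by (subst holomorphic_mfd_map_cong[OF M, where h = "\<lambda>l. Some (x + u l)"]) auto
    moreover have "Some ` E \<subseteq> points_of riemann_sphere"
      by (auto simp: riemann_sphere_def)
    ultimately have ?b
      using fu u0 assms(2) by (auto simp: holomorphic_motion_def inj_on_def)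
    moreover have "holomorphic_motion complex_plane \<Omega> l0 E (\<lambda>l x. x + u l)"
      using plane u0 by (auto simp: holomorphic_motion_def inj_on_def complex_plane_def)
    ultimately show ?thesis
      using fu by (intro conjI exI[of _ "\<lambda>l x. x + u l"]) auto
  qed
  show ?thesis
    using ba ca abc by argo
qed

end
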